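(* As formal power series in $q$ (equivalently, for $|q|<1$), $$\sum_{n=0}^{\infty}\sigma_{od}\mathrm{moex}(n)\,q^n= \frac{(-q;q^2)_{\infty}}{(q^2;q^2)_{\infty}}\bigl(1+\sigma^*(-q)\bigr)$$ and $$\sum_{n=0}^{\infty}\sigma_{od}\mathrm{meex}(n)\,q^n=2 \sum_{n=0}^{\infty}p_{ed}(n)q^n,$$ where $\sigma^*(q):=2\sum_{n=1}^{\infty}\frac{(-1)^nq^{n^2}}{(q;q^2)_n}$.
   Context: Notation: $(a;q)_0:=1$, $(a;q)_n:=\prod_{k=0}^{n-1}(1-aq^k)$, $(a;q)_\infty:=\lim_{n\to\infty}(a;q)_n$. For $n\ge 0$, $\mathcal{P}_{od}(n)$ is the set of all partitions of $n$ in which no odd part is repeated (even parts may appear with any multiplicity), and $p_{ed}(n)$ is the number of partitions of $n$ in which no even part is repeated (odd parts may appear with any multiplicity), with $p_{ed}(0)=1$. The empty partition is the unique element of $\mathcal{P}_{od}(0)$. For $\lambda\in\mathcal{P}_{od}(n)$, $\mathrm{moex}(\lambda)$ (resp. $\mathrm{meex}(\lambda)$) is the smallest positive odd (resp. positive even) integer that is not a part of $\lambda$. Define $$\sigma_{od}\mathrm{moex}(n):=\sum_{\lambda\in\mathcal{P}_{od}(n)}\mathrm{moex}(\lambda),\qquad \sigma_{od}\mathrm{meex}(n):=\sum_{\lambda\in\mathcal{P}_{od}(n)}\mathrm{meex}(\lambda).$$ *)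

theory Defs
  imports
    "HOL-Computational_Algebra.Formal_Power_Series"
    "HOL-Library.Multiset"
begin

section \<open>Partitions\<close>

definition partitions_of :: "nat \<Rightarrow> nat multiset set" where
  "partitions_of n = {\<mu>. 0 \<notin># \<mu> \<and> sum_mset \<mu> = n}"

definition P_od :: "nat \<Rightarrow> nat multiset set" where
  "P_od n = {\<mu> \<in> partitions_of n. \<forall>i. odd i \<longrightarrow> count \<mu> i \<le> 1}"

definition p_ed :: "nat \<Rightarrow> nat" where
  "p_ed n = card {\<mu> \<in> partitions_of n. \<forall>i. even i \<longrightarrow> count \<mu> i \<le> 1}"

definition moex :: "nat multiset \<Rightarrow> nat" where
  "moex \<mu> = (LEAST k. odd k \<and> k \<notin># \<mu>)"

definition meex :: "nat multiset \<Rightarrow> nat" where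
  "meex \<mu> = (LEAST k. 0 < k \<and> even k \<and> k \<notin># \<mu>)"

definition sigma_od_moex :: "nat \<Rightarrow> nat" where
  "sigma_od_moex n = (\<Sum>\<mu>\<in>P_od n. moex \<mu>)"

definition sigma_od_meex :: "nat \<Rightarrow> nat" where
  "sigma_od_meex n = (\<Sum>\<mu>\<in>P_od n. meex \<mu>)"

lemma finite_partitions_of: "finite (partitions_of n)"
proof -
  have size_le: "size \<mu> \<le> sum_mset \<mu>" if "0 \<notin># \<mu>" for \<mu> :: "nat multiset"
    using that by (induction \<mu>) auto
  have part_le: "i \<le> sum_mset \<mu>" if "i \<in># \<mu>" for i :: nat and \<mu>
    using multi_member_split[OF that] by auto
  have "partitions_of n \<subseteq> (\<Union>k\<le>n. multisets_of_size {..n} k)"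
    using size_le part_le unfolding partitions_of_def multisets_of_size_def by blast
  moreover have "finite (\<Union>k\<le>n. multisets_of_size {..n} k)"
    by (intro finite_UN_I finite_multisets_of_size) auto
  ultimately show ?thesis
    by (rule finite_subset)
qed

lemma finite_P_od: "finite (P_od n)"
  using finite_partitions_of[of n] by (simp add: P_od_def)


section \<open>q-series in the ring of formal power series\<close>

text \<open>
  Infinite products and sums are limits in the standard topology on \<^typ>\<open>'a fps\<close>, in which
  convergence means that every coefficient is eventually constant.
\<close>

definition qpochhammer :: "'a::comm_ring_1 \<Rightarrow> 'a \<Rightarrow> nat \<Rightarrow> 'a" where
  "qpochhammer a q n = (\<Prod>k<n. 1 - a * q ^ k)"

definition qpochhammer_inf :: "'a::comm_ring_1 fps \<Rightarrow> 'a fps \<Rightarrow> 'a fps" where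
  "qpochhammer_inf a q = lim (\<lambda>n. qpochhammer a q n)"

definition sigma_star :: "'a::field fps \<Rightarrow> 'a fps" where
  "sigma_star q =
     2 * (\<Sum>n. (- 1) ^ Suc n * q ^ ((Suc n)\<^sup>2) / qpochhammer q (q\<^sup>2) (Suc n))"

unbundle fps_syntax

lemma fps_nth_mult_power_eq_0:
  fixes a q :: "'a::comm_ring_1 fps"
  assumes "q $ 0 = 0" "k < n"
  shows "(a * q ^ n) $ k = 0"
proof -
  have "(q ^ n) $ i = 0" if "i < n" for i
    using assms(1) that by (intro startsby_zero_power_prefix[rule_format]) auto
  then show ?thesis
    using assms(2) by (simp add: fps_mult_nth)
qed

lemma fps_convergentI:
  fixes f :: "nat \<Rightarrow> 'a::group_add fps"
  assumes "\<And>n k. k < n \<Longrightarrow> f (Suc n) $ k = f n $ k"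
  shows "convergent f"
proof -
  have eq: "f n $ k = f (Suc k) $ k" if "Suc k \<le> n" for n k
    using that by (induction rule: dec_induct) (auto simp: assms)
  have "f \<longlonglongrightarrow> Abs_fps (\<lambda>k. f (Suc k) $ k)"
  proof (rule tendsto_fpsI)
    fix k :: nat
    show "eventually (\<lambda>n. f n $ k = Abs_fps (\<lambda>k. f (Suc k) $ k) $ k) sequentially"
      using eventually_ge_at_top[of "Suc k"]
      by (rule eventually_mono) (unfold fps_nth_Abs_fps, erule eq)
  qed
  then show ?thesis
    by (rule convergentI)
qed

lemma convergent_qpochhammer:
  fixes a q :: "'a::comm_ring_1 fps"
  assumes "q $ 0 = 0"
  shows "convergent (\<lambda>n. qpochhammer a q n)"
proof (rule fps_convergentI)
  fix n k :: nat
  assume "k < n"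
  have "qpochhammer a q (Suc n) = qpochhammer a q n - (qpochhammer a q n * a) * q ^ n"
    by (simp add: qpochhammer_def algebra_simps)
  then show "qpochhammer a q (Suc n) $ k = qpochhammer a q n $ k"
    using fps_nth_mult_power_eq_0[OF assms \<open>k < n\<close>] by simp
qed

lemma summable_sigma_star:
  fixes q :: "'a::field fps"
  assumes "q $ 0 = 0"
  shows "summable (\<lambda>n. (- 1) ^ Suc n * q ^ ((Suc n)\<^sup>2) / qpochhammer q (q\<^sup>2) (Suc n))"
    (is "summable ?f")
proof -
  have "convergent (\<lambda>n. \<Sum>i<n. ?f i)"
  proof (rule fps_convergentI)
    fix n k :: nat
    assume "k < n"
    have unit: "qpochhammer q (q\<^sup>2) m $ 0 = 1" for m
      using assms by (induction m) (simp_all add: qpochhammer_def)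
    have "?f n = ((- 1) ^ Suc n * inverse (qpochhammer q (q\<^sup>2) (Suc n))) * q ^ ((Suc n)\<^sup>2)"
      using unit[of "Suc n"] by (simp only: fps_divide_unit one_neq_zero not_False_eq_True mult_ac)
    moreover have "k < (Suc n)\<^sup>2"
      using \<open>k < n\<close> by (simp add: power2_eq_square)
    ultimately have "?f n $ k = 0"
      by (simp only: fps_nth_mult_power_eq_0[OF assms])
    then show "(\<Sum>i<Suc n. ?f i) $ k = (\<Sum>i<n. ?f i) $ k"
      by (simp only: sum.lessThan_Suc fps_add_nth add_0_right)
  qed
  then show ?thesis
    by (simp add: summable_iff_convergent)
qed

end

theory Submission
  imports Defs
begin

text \<open>
  Write the minimal excludant as a sum of indicators: \<open>moex \<lambda> = 1 + 2 t\<close>, where \<open>t\<close> counts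
  the \<open>m \<ge> 1\<close> for which \<open>1, 3, \<dots>, 2m - 1\<close> all are parts of \<open>\<lambda>\<close>, and likewise
  \<open>meex \<lambda> = 2 + 2 t\<close> for \<open>2, 4, \<dots>, 2m\<close>. If \<open>G\<close> is the generating function of all partitions
  without repeated odd parts, then requiring the first \<open>m\<close> odd parts multiplies \<open>G\<close> by
  \<open>q\<^bsup>m\<^sup>2\<^esup> / (-q;q\<^sup>2)\<^sub>m\<close>, and requiring the first \<open>m\<close> even parts multiplies it by
  \<open>q\<^bsup>m(m+1)\<^esup>\<close>. Summing over \<open>m\<close> gives the first identity at once. For the second one it
  remains to apply Gauss's identity \<open>\<Sum> q\<^bsup>m(m+1)/2\<^esup> = (q;q)\<^sub>\<infinity> (-q;q)\<^sub>\<infinity>\<^sup>2\<close>, with \<open>q\<^sup>2\<close> in place of \<open>q\<close>,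
  and Euler's identity \<open>(q;q\<^sup>2)\<^sub>\<infinity> (-q;q)\<^sub>\<infinity> = 1\<close>. Gauss's identity is the limit of a finite one,
  an instance of the q-binomial theorem.
\<close>

subsection \<open>Congruence of power series\<close>

text \<open>Identities between infinite products are proved modulo X^n for every n, with finite
  truncations in place of limits. Stating this by divisibility makes compatibility with products a
  matter of ring algebra; \<open>fps_cong_iff\<close> gives the view by coefficients.\<close>

definition fps_cong :: "nat \<Rightarrow> 'a::comm_ring_1 fps \<Rightarrow> 'a fps \<Rightarrow> bool" where
  "fps_cong n f g \<longleftrightarrow> fps_X ^ n dvd f - g"

lemma fps_X_power_dvd_iff:
  fixes f :: "'a::comm_ring_1 fps"
  shows "fps_X ^ n dvd f \<longleftrightarrow> (\<forall>k<n. f $ k = 0)"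
proof
  assume "fps_X ^ n dvd f"
  then show "\<forall>k<n. f $ k = 0"
    by (auto simp: fps_X_power_mult_nth elim!: dvdE)
next
  assume "\<forall>k<n. f $ k = 0"
  then have "f = fps_X ^ n * fps_shift n f"
    by (auto simp: fps_eq_iff fps_X_power_mult_nth)
  then show "fps_X ^ n dvd f"
    by (rule dvdI)
qed

lemma fps_cong_iff: "fps_cong n f g \<longleftrightarrow> (\<forall>k<n. f $ k = g $ k)"
  by (simp add: fps_cong_def fps_X_power_dvd_iff)

lemma fps_cong_refl [simp]: "fps_cong n f f"
  by (simp add: fps_cong_def)

lemma fps_cong_sym: "fps_cong n f g \<Longrightarrow> fps_cong n g f"
  by (simp add: fps_cong_iff)

lemma fps_cong_trans [trans]: "fps_cong n f g \<Longrightarrow> fps_cong n g h \<Longrightarrow> fps_cong n f h"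
  by (simp add: fps_cong_iff)

lemma fps_cong_mono: "fps_cong n f g \<Longrightarrow> m \<le> n \<Longrightarrow> fps_cong m f g"
  by (simp add: fps_cong_iff)

lemma fps_cong_add: "fps_cong n f g \<Longrightarrow> fps_cong n f' g' \<Longrightarrow> fps_cong n (f + f') (g + g')"
  by (simp add: fps_cong_iff)

lemma fps_cong_sum: "(\<And>i. i \<in> A \<Longrightarrow> fps_cong n (f i) (g i)) \<Longrightarrow> fps_cong n (sum f A) (sum g A)"
  by (simp add: fps_cong_iff fps_sum_nth)

lemma fps_cong_mult:
  assumes "fps_cong n f g" "fps_cong n f' g'"
  shows "fps_cong n (f * f') (g * g')"
proof -
  have "f * f' - g * g' = f * (f' - g') + (f - g) * g'"
    by (simp add: algebra_simps)
  then show ?thesis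
    using assms unfolding fps_cong_def by (simp add: dvd_add)
qed

lemma fps_cong_power: "fps_cong n f g \<Longrightarrow> fps_cong n (f ^ k) (g ^ k)"
  by (induction k) (auto intro: fps_cong_mult)

text \<open>Since X divides q, a factor q^m gains m orders of precision. In
  \<open>gauss_triangular\<close> this offsets the low accuracy of the outer q-binomial
  coefficients.\<close>

lemma fps_cong_mult_power:
  assumes "q $ 0 = 0" "fps_cong n f g"
  shows "fps_cong (m + n) (q ^ m * f) (q ^ m * g)"
proof -
  have "fps_X dvd q"
    using fps_X_power_dvd_iff[of 1 q] assms(1) by simp
  then have "fps_X ^ m * fps_X ^ n dvd q ^ m * (f - g)"
    using assms(2) unfolding fps_cong_def by (intro mult_dvd_mono dvd_power_same)
  then show ?thesis
    by (simp add: fps_cong_def power_add algebra_simps)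
qed

lemma fps_cong_cancel:
  fixes f g u :: "'a::field fps"
  assumes "fps_cong n (f * u) (g * u)" "u $ 0 \<noteq> 0"
  shows "fps_cong n f g"
proof -
  have "fps_cong n (f * u * inverse u) (g * u * inverse u)"
    by (rule fps_cong_mult[OF assms(1) fps_cong_refl])
  moreover have "u * inverse u = 1"
    using assms(2) by (rule inverse_mult_eq_1')
  ultimately show ?thesis
    by (simp only: mult.assoc mult_1_right)
qed

lemma fps_eqI_cong: "(\<And>n. fps_cong n f g) \<Longrightarrow> f = g"
  by (auto simp: fps_cong_iff fps_eq_iff)

text \<open>By induction all f m with m \<ge> n agree modulo X^n, and each coefficient of the limit
  is an eventual value of the coefficients of f m.\<close>

lemma fps_cong_limit:
  fixes f :: "nat \<Rightarrow> 'a::comm_ring_1 fps"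
  assumes "f \<longlonglongrightarrow> L" "\<And>n. fps_cong n (f (Suc n)) (f n)"
  shows "fps_cong n L (f n)"
  unfolding fps_cong_iff
proof (intro allI impI)
  fix k assume k: "k < n"
  have eq: "f m $ k = f n $ k" if "n \<le> m" for m
    using that
  proof (induction rule: dec_induct)
    case (step m)
    then show ?case
      using assms(2)[of m] k by (simp add: fps_cong_iff)
  qed simp
  have "eventually (\<lambda>m. f m $ k = L $ k) sequentially"
    using assms(1) by (simp add: tendsto_fps_iff)
  then obtain M where M: "\<forall>m\<ge>M. f m $ k = L $ k"
    unfolding eventually_sequentially ..
  have "L $ k = f (max M n) $ k"
    using M by simp
  also have "\<dots> = f n $ k"
    by (rule eq) simp
  finally show "L $ k = f n $ k" .
qed


subsection \<open>q-Pochhammer symbols\<close>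

lemma qpochhammer_Suc: "qpochhammer a q (Suc n) = qpochhammer a q n * (1 - a * q ^ n)"
  by (simp add: qpochhammer_def)

lemma qpochhammer_0 [simp]: "qpochhammer a q 0 = 1"
  by (simp add: qpochhammer_def)

lemma qpochhammer_nth_0:
  fixes a q :: "'a::comm_ring_1 fps"
  assumes "a $ 0 = 0"
  shows "qpochhammer a q n $ 0 = 1"
  using assms by (induction n) (simp_all add: qpochhammer_Suc)

text \<open>The new factor differs from 1 by a multiple of q^n, whatever a is.\<close>

lemma fps_cong_qpochhammer_Suc:
  fixes a q :: "'a::comm_ring_1 fps"
  assumes "q $ 0 = 0"
  shows "fps_cong n (qpochhammer a q (Suc n)) (qpochhammer a q n)"
proof -
  have "qpochhammer a q (Suc n) = qpochhammer a q n - qpochhammer a q n * a * q ^ n"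
    by (simp add: qpochhammer_Suc algebra_simps)
  then show ?thesis
    by (simp add: fps_cong_iff fps_nth_mult_power_eq_0[OF assms])
qed

lemma fps_cong_qpochhammer_inf:
  fixes a q :: "'a::comm_ring_1 fps"
  assumes "q $ 0 = 0"
  shows "fps_cong n (qpochhammer_inf a q) (qpochhammer a q n)"
  using convergent_qpochhammer[OF assms] fps_cong_qpochhammer_Suc[OF assms]
  unfolding qpochhammer_inf_def convergent_LIMSEQ_iff by (rule fps_cong_limit)

lemma fps_cong_qpochhammer:
  fixes a q :: "'a::comm_ring_1 fps"
  assumes "q $ 0 = 0" "n \<le> m" "n \<le> k"
  shows "fps_cong n (qpochhammer a q m) (qpochhammer a q k)"
proof -
  have inf: "fps_cong n (qpochhammer_inf a q) (qpochhammer a q i)" if "n \<le> i" for i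
    using fps_cong_qpochhammer_inf[OF assms(1)] that by (rule fps_cong_mono)
  show ?thesis
    using fps_cong_sym[OF inf[OF assms(2)]] inf[OF assms(3)] by (rule fps_cong_trans)
qed

lemma qpochhammer_inf_nth_0:
  fixes a q :: "'a::comm_ring_1 fps"
  assumes "a $ 0 = 0" "q $ 0 = 0"
  shows "qpochhammer_inf a q $ 0 = 1"
  using fps_cong_qpochhammer_inf[OF assms(2), of 1 a] qpochhammer_nth_0[OF assms(1)]
  by (simp add: fps_cong_iff)

lemma qpochhammer_mult_uminus:
  "qpochhammer a q n * qpochhammer (- a) q n = qpochhammer (a\<^sup>2) (q\<^sup>2) n"
  unfolding qpochhammer_def prod.distrib[symmetric]
  by (rule prod.cong) (simp_all add: algebra_simps power2_eq_square power_mult_distrib)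

text \<open>The factors 1 - q^i for 1 \<le> i \<le> 2n are sorted by the parity of i.\<close>

lemma qpochhammer_even_odd:
  "qpochhammer q (q\<^sup>2) n * qpochhammer (q\<^sup>2) (q\<^sup>2) n = qpochhammer q q (2 * n)"
proof (induction n)
  case (Suc n)
  have *: "(q\<^sup>2) ^ n = q ^ (2 * n)" "q\<^sup>2 * q ^ (2 * n) = q * q ^ Suc (2 * n)"
    by (simp_all add: power_mult power2_eq_square mult.assoc)
  have "qpochhammer q (q\<^sup>2) (Suc n) * qpochhammer (q\<^sup>2) (q\<^sup>2) (Suc n) =
      qpochhammer q (q\<^sup>2) n * qpochhammer (q\<^sup>2) (q\<^sup>2) n * ((1 - q * q ^ (2 * n)) * (1 - q * q ^ Suc (2 * n)))"
    unfolding qpochhammer_Suc * by (simp only: mult_ac)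
  then show ?case
    by (simp add: Suc.IH qpochhammer_Suc mult.assoc)
qed simp

lemma qpochhammer_inf_mult_uminus:
  fixes a q :: "'a::comm_ring_1 fps"
  assumes "q $ 0 = 0"
  shows "qpochhammer_inf a q * qpochhammer_inf (- a) q = qpochhammer_inf (a\<^sup>2) (q\<^sup>2)"
proof (rule fps_eqI_cong)
  fix n
  have "fps_cong n (qpochhammer_inf a q * qpochhammer_inf (- a) q)
      (qpochhammer a q n * qpochhammer (- a) q n)"
    using assms by (intro fps_cong_mult fps_cong_qpochhammer_inf)
  also have "\<dots> = qpochhammer (a\<^sup>2) (q\<^sup>2) n"
    by (rule qpochhammer_mult_uminus)
  also have "fps_cong n \<dots> (qpochhammer_inf (a\<^sup>2) (q\<^sup>2))"
    using assms by (intro fps_cong_sym[OF fps_cong_qpochhammer_inf]) (simp add: power2_eq_square)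
  finally show "fps_cong n (qpochhammer_inf a q * qpochhammer_inf (- a) q)
      (qpochhammer_inf (a\<^sup>2) (q\<^sup>2))" .
qed

text \<open>Euler's identity. After multiplication by (q;q)_n the finite product becomes (q;q)_{2n},
  which agrees with (q;q)_n modulo X^n, and the unit (q;q)_n cancels.\<close>

lemma qpochhammer_inf_odd_mult_uminus:
  fixes q :: "'a::field fps"
  assumes "q $ 0 = 0"
  shows "qpochhammer_inf q (q\<^sup>2) * qpochhammer_inf (- q) q = 1"
proof (rule fps_eqI_cong)
  fix n
  have "qpochhammer q (q\<^sup>2) n * qpochhammer (- q) q n * qpochhammer q q n = qpochhammer q q (2 * n)"
    unfolding qpochhammer_even_odd[symmetric] qpochhammer_mult_uminus[symmetric] by (simp only: mult_ac)
  also have "fps_cong n \<dots> (1 * qpochhammer q q n)"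
    using assms by (simp add: fps_cong_qpochhammer)
  finally have "fps_cong n (qpochhammer q (q\<^sup>2) n * qpochhammer (- q) q n) 1"
    by (rule fps_cong_cancel) (simp add: qpochhammer_nth_0 assms)
  moreover have "fps_cong n (qpochhammer_inf q (q\<^sup>2) * qpochhammer_inf (- q) q)
      (qpochhammer q (q\<^sup>2) n * qpochhammer (- q) q n)"
    using assms by (intro fps_cong_mult fps_cong_qpochhammer_inf) (auto simp: power2_eq_square)
  ultimately show "fps_cong n (qpochhammer_inf q (q\<^sup>2) * qpochhammer_inf (- q) q) 1"
    using fps_cong_trans by blast
qed


subsection \<open>Gauss's identity for triangular exponents\<close>

fun qbinomial :: "'a::comm_ring_1 \<Rightarrow> nat \<Rightarrow> nat \<Rightarrow> 'a" where
  "qbinomial q n 0 = 1"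
| "qbinomial q 0 (Suc k) = 0"
| "qbinomial q (Suc n) (Suc k) = qbinomial q n k + q ^ Suc k * qbinomial q n (Suc k)"

lemma qbinomial_eq_0: "n < k \<Longrightarrow> qbinomial q n k = 0"
  by (induction q n k rule: qbinomial.induct) auto

text \<open>The quotient formula for Gaussian binomials with denominators cleared. The q-Pascal rule
  reduces it to (1 - q^k) + q^k (1 - q^j) = 1 - q^(j+k).\<close>

lemma qbinomial_mult_qpochhammer:
  "qbinomial q (j + k) k * (qpochhammer q q k * qpochhammer q q j) = qpochhammer q q (j + k)"
proof (induction "j + k" arbitrary: j k)
  case (Suc n)
  show ?case
  proof (cases k)
    case k: (Suc k')
    show ?thesis
    proof (cases j)
      case 0
      then show ?thesis
        using Suc.hyps(1)[of 0 k'] Suc.hyps(2) k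
        by (simp add: qbinomial_eq_0 qpochhammer_Suc algebra_simps)
    next
      case j: (Suc j')
      have 1: "qbinomial q (j + k') k' * (qpochhammer q q k' * qpochhammer q q j) = qpochhammer q q (j + k')"
        using Suc.hyps(1)[of j k'] Suc.hyps(2) k by simp
      have 2: "qbinomial q (j + k') k * (qpochhammer q q k * qpochhammer q q j') = qpochhammer q q (j + k')"
        using Suc.hyps(1)[of j' k] Suc.hyps(2) k j by simp
      have "qbinomial q (j + k) k * (qpochhammer q q k * qpochhammer q q j)
          = (qbinomial q (j + k') k' + q ^ k * qbinomial q (j + k') k) * (qpochhammer q q k * qpochhammer q q j)"
        by (simp add: k)
      also have "\<dots> = qbinomial q (j + k') k' * (qpochhammer q q k' * qpochhammer q q j) * (1 - q ^ k)
          + q ^ k * (1 - q ^ j) * (qbinomial q (j + k') k * (qpochhammer q q k * qpochhammer q q j'))"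
        by (simp add: k j qpochhammer_Suc algebra_simps)
      also have "\<dots> = qpochhammer q q (j + k') * (1 - q ^ (j + k))"
        unfolding 1 2 by (simp add: algebra_simps power_add)
      also have "\<dots> = qpochhammer q q (j + k)"
        by (simp add: k qpochhammer_Suc)
      finally show ?thesis .
    qed
  qed simp
qed simp

text \<open>Splitting off the first factor x + y leaves the same product with yq for y, hence the
  induction over arbitrary y.\<close>

lemma q_binomial_theorem:
  fixes x y q :: "'a::comm_ring_1"
  shows "(\<Prod>k<n. x + y * q ^ k) = (\<Sum>j\<le>n. q ^ (j choose 2) * qbinomial q n j * x ^ (n - j) * y ^ j)"
proof (induction n arbitrary: y)
  case (Suc n)
  let ?t = "\<lambda>j. q ^ (j choose 2) * q ^ j * qbinomial q n j * y ^ j"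
  have "(\<Prod>k<Suc n. x + y * q ^ k) = (x + y) * (\<Prod>k<n. x + (y * q) * q ^ k)"
    by (subst prod.lessThan_Suc_shift) (simp add: mult.assoc)
  also have "\<dots> = (x + y) * (\<Sum>j\<le>n. ?t j * x ^ (n - j))"
    unfolding Suc.IH by (simp add: power_mult_distrib mult_ac)
  also have "\<dots> = (\<Sum>j\<le>n. ?t j * x ^ (Suc n - j)) + (\<Sum>j\<le>n. ?t j * y * x ^ (n - j))"
    unfolding sum_distrib_left sum.distrib[symmetric]
    by (rule sum.cong) (simp_all add: Suc_diff_le algebra_simps)
  \<comment> \<open>The added term j = n + 1 vanishes; with it, shifting the index aligns this sum
    with the other one.\<close>
  also have "(\<Sum>j\<le>n. ?t j * x ^ (Suc n - j)) = (\<Sum>j\<le>Suc n. ?t j * x ^ (Suc n - j))"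
    by (simp add: qbinomial_eq_0)
  also have "\<dots> = x ^ Suc n + (\<Sum>j\<le>n. ?t (Suc j) * x ^ (n - j))"
    by (subst sum.atMost_Suc_shift) (simp add: binomial_eq_0)
  \<comment> \<open>Termwise this is the q-Pascal rule, since C(j+1,2) = C(j,2) + j.\<close>
  also have "\<dots> + (\<Sum>j\<le>n. ?t j * y * x ^ (n - j))
      = x ^ Suc n + (\<Sum>j\<le>n. q ^ (Suc j choose 2) * qbinomial q (Suc n) (Suc j) * x ^ (n - j) * y ^ Suc j)"
    unfolding add.assoc sum.distrib[symmetric]
    by (intro arg_cong2[where f = "(+)"] refl sum.cong)
       (simp add: numeral_2_eq_2 power_add algebra_simps)
  also have "\<dots> = (\<Sum>j\<le>Suc n. q ^ (j choose 2) * qbinomial q (Suc n) j * x ^ (Suc n - j) * y ^ j)"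
    unfolding sum.atMost_Suc_shift by (simp add: binomial_eq_0)
  finally show ?case .
qed (simp add: binomial_eq_0)

lemma square_eq_choose_2: "n * n = n + 2 * (n choose 2)" for n :: nat
  by (induction n) (simp_all add: numeral_2_eq_2)

lemma choose_2_add: "(a + b) choose 2 = (a choose 2) + (b choose 2) + a * b"
  by (induction a) (simp_all add: numeral_2_eq_2)

text \<open>The q-binomial theorem with \<open>x = q\<^sup>n\<close> and \<open>y = 1\<close>: the factors of
  the product come in pairs, and so do the terms of the sum.\<close>

lemma gauss_finite:
  fixes q :: "'a::idom"
  assumes "q \<noteq> 0"
  shows "(\<Sum>i\<le>n. q ^ (Suc i choose 2) * (qbinomial q (2 * n + 1) (n - i) + qbinomial q (2 * n + 1) (n + 1 + i)))
     = 2 * (qpochhammer (- q) q n)\<^sup>2"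
proof -
  \<comment> \<open>The power of q common to both sides. In the product, the factors k < n
    contribute q^k each, and the n + 1 remaining ones q^n each.\<close>
  define A where "A = (n choose 2) + n + n * n"
  let ?b = "qbinomial q (2 * n + 1)"
  let ?t = "\<lambda>j. q ^ (j choose 2) * ?b j * (q ^ n) ^ (2 * n + 1 - j)"
  have t: "?t j = ?b j * q ^ ((j choose 2) + n * (2 * n + 1 - j))" for j
    by (simp add: power_add power_mult mult_ac)
  \<comment> \<open>The terms with indices n - i and n + 1 + i carry the same power of q, with
    exponent A + C(i+1,2).\<close>
  have low: "?t (n - i) = q ^ A * (q ^ (Suc i choose 2) * ?b (n - i))" if i: "i \<le> n" for i
  proof -
    obtain d where d: "n = d + i"
      using le_Suc_ex[OF i] by (auto simp: add.commute)
    have "(d choose 2) + n * (n + 1 + i) = A + (Suc i choose 2)"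
      using choose_2_add[of d i] square_eq_choose_2[of i]
      by (simp add: A_def d numeral_2_eq_2 algebra_simps)
    moreover have "n - i = d" "2 * n + 1 - d = n + 1 + i"
      using d by auto
    ultimately show ?thesis
      unfolding t by (simp only: power_add mult_ac)
  qed
  have high: "?t (n + 1 + i) = q ^ A * (q ^ (Suc i choose 2) * ?b (n + 1 + i))" if i: "i \<le> n" for i
  proof -
    obtain d where d: "n = d + i"
      using le_Suc_ex[OF i] by (auto simp: add.commute)
    have "(n + 1 + i choose 2) + n * d = A + (Suc i choose 2)"
      using choose_2_add[of n "Suc i"]
      by (simp add: A_def d numeral_2_eq_2 algebra_simps)
    moreover have "2 * n + 1 - (n + 1 + i) = d"
      using d by auto
    ultimately show ?thesis
      unfolding t by (simp only: power_add mult_ac)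
  qed
  have "(\<Sum>j\<le>2 * n + 1. ?t j) = (\<Sum>j\<in>{..n} \<union> {n+1..2*n+1}. ?t j)"
    by (intro sum.cong refl) auto
  also have "\<dots> = (\<Sum>j\<le>n. ?t j) + (\<Sum>j=n+1..2*n+1. ?t j)"
    by (rule sum.union_disjoint) auto
  also have "(\<Sum>j\<le>n. ?t j) = (\<Sum>i\<le>n. ?t (n - i))"
    by (rule sum.reindex_bij_witness[of _ "\<lambda>i. n - i" "\<lambda>i. n - i"]) auto
  also have "(\<Sum>j=n+1..2*n+1. ?t j) = (\<Sum>i\<le>n. ?t (n + 1 + i))"
    by (rule sum.reindex_bij_witness[of _ "\<lambda>i. n + 1 + i" "\<lambda>j. j - (n + 1)"]) auto
  also have "(\<Sum>i\<le>n. ?t (n - i)) = (\<Sum>i\<le>n. q ^ A * (q ^ (Suc i choose 2) * ?b (n - i)))"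
    by (intro sum.cong refl low) simp
  also have "(\<Sum>i\<le>n. ?t (n + 1 + i)) = (\<Sum>i\<le>n. q ^ A * (q ^ (Suc i choose 2) * ?b (n + 1 + i)))"
    by (intro sum.cong refl high) simp
  finally have sum: "(\<Sum>j\<le>2 * n + 1. ?t j) = q ^ A * (\<Sum>i\<le>n. q ^ (Suc i choose 2) * (?b (n - i) + ?b (n + 1 + i)))"
    by (simp only: sum_distrib_left distrib_left sum.distrib)
  have P: "qpochhammer (- q) q n = (\<Prod>k<n. 1 + q ^ Suc k)"
    by (simp add: qpochhammer_def)
  have "(\<Prod>k<2 * n + 1. q ^ n + q ^ k) = (\<Prod>k\<in>{..<n} \<union> {n..<2*n+1}. q ^ n + q ^ k)"
    by (intro prod.cong refl) auto
  also have "\<dots> = (\<Prod>k<n. q ^ n + q ^ k) * (\<Prod>k=n..<2*n+1. q ^ n + q ^ k)"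
    by (rule prod.union_disjoint) auto
  also have "(\<Prod>k=n..<2*n+1. q ^ n + q ^ k) = (\<Prod>k<Suc n. q ^ n * (1 + q ^ k))"
    by (rule prod.reindex_bij_witness[of _ "\<lambda>i. n + i" "\<lambda>j. j - n"])
       (auto simp: distrib_left simp flip: power_add)
  \<comment> \<open>The unpaired middle factor q^n + q^n is the source of the 2.\<close>
  also have "\<dots> = 2 * q ^ n * (\<Prod>k<n. q ^ n * (1 + q ^ Suc k))"
    by (subst prod.lessThan_Suc_shift) simp
  also have "\<dots> = 2 * q ^ n * q ^ (n * n) * qpochhammer (- q) q n"
    by (simp add: P prod.distrib power_mult)
  also have "(\<Prod>k<n. q ^ n + q ^ k) = (\<Prod>k<n. q ^ k * (1 + q ^ (n - k)))"
    by (intro prod.cong) (auto simp: algebra_simps simp flip: power_add)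
  also have "\<dots> = q ^ (n choose 2) * (\<Prod>k<n. 1 + q ^ (n - k))"
  proof -
    have "(\<Prod>k<n. q ^ k) = q ^ (n choose 2)"
      by (induction n) (simp_all add: numeral_2_eq_2 power_add)
    then show ?thesis
      by (simp add: prod.distrib)
  qed
  also have "(\<Prod>k<n. 1 + q ^ (n - k)) = qpochhammer (- q) q n"
    unfolding P by (rule prod.reindex_bij_witness[of _ "\<lambda>k. n - Suc k" "\<lambda>k. n - Suc k"]) (auto simp: Suc_diff_Suc simp flip: power_Suc)
  finally have prod: "(\<Prod>k<2 * n + 1. q ^ n + q ^ k) = q ^ A * (2 * (qpochhammer (- q) q n)\<^sup>2)"
    by (simp add: A_def power_add power2_eq_square mult_ac)
  have "(\<Prod>k<2 * n + 1. q ^ n + q ^ k) = (\<Sum>j\<le>2 * n + 1. ?t j)"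
    using q_binomial_theorem[where n = "2 * n + 1" and x = "q ^ n" and y = 1 and q = q] by (simp only: mult_1_left power_one mult_1_right)
  then have "q ^ A * (\<Sum>i\<le>n. q ^ (Suc i choose 2) * (?b (n - i) + ?b (n + 1 + i)))
      = q ^ A * (2 * (qpochhammer (- q) q n)\<^sup>2)"
    unfolding sum prod by (rule sym)
  then show ?thesis
    using assms by (simp only: mult_cancel_left power_eq_0_iff) simp
qed

text \<open>With both lower indices large, the Gaussian binomial tends to 1/(q;q)_inf: in the
  quotient formula all three symbols may be replaced by (q;q)_inf modulo X^m.\<close>

lemma fps_cong_qbinomial:
  fixes q :: "'a::field fps"
  assumes q: "q $ 0 = 0" and "m \<le> j" "m \<le> k"
  shows "fps_cong m (qpochhammer_inf q q * qbinomial q (j + k) k) 1"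
proof -
  have inf: "fps_cong m (qpochhammer_inf q q) (qpochhammer q q i)" if "m \<le> i" for i
    using fps_cong_mono[OF fps_cong_qpochhammer_inf[OF q] that] .
  have "fps_cong m (qbinomial q (j + k) k * (qpochhammer_inf q q * qpochhammer_inf q q))
      (qbinomial q (j + k) k * (qpochhammer q q k * qpochhammer q q j))"
    using assms by (intro fps_cong_mult fps_cong_refl inf)
  also have "\<dots> = qpochhammer q q (j + k)"
    by (rule qbinomial_mult_qpochhammer)
  also have "fps_cong m \<dots> (1 * qpochhammer_inf q q)"
    using assms by (simp add: fps_cong_sym[OF inf])
  finally have "fps_cong m ((qpochhammer_inf q q * qbinomial q (j + k) k) * qpochhammer_inf q q) (1 * qpochhammer_inf q q)"
    by (simp add: mult_ac)
  then show ?thesis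
    by (rule fps_cong_cancel) (simp add: qpochhammer_inf_nth_0 q)
qed

text \<open>Multiplying \<open>gauss_finite\<close> by (q;q)_inf turns every binomial into 1 up to
  the required order. Each exponent then occurs twice, and the 2 cancels in characteristic
  zero.\<close>

lemma gauss_triangular:
  fixes q :: "'a::field_char_0 fps"
  assumes q: "q $ 0 = 0" "q \<noteq> 0"
  shows "fps_cong n (qpochhammer_inf q q * (qpochhammer_inf (- q) q)\<^sup>2) (\<Sum>i\<le>n. q ^ (Suc i choose 2))"
proof -
  let ?b = "qbinomial q (2 * n + 1)" and ?I = "qpochhammer_inf q q"
  \<comment> \<open>The binomial is controlled only to order n - i, but C(i+1,2) \<ge> i makes up
    the loss.\<close>
  have b: "fps_cong n (q ^ (Suc i choose 2) * (?I * ?b j)) (q ^ (Suc i choose 2) * 1)"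
    if "i \<le> n" "j = n - i \<or> j = n + 1 + i" for i j
  proof -
    have "fps_cong (n - i) (?I * qbinomial q ((2 * n + 1 - j) + j) j) 1"
      using that by (intro fps_cong_qbinomial q) auto
    moreover have "(2 * n + 1 - j) + j = 2 * n + 1"
      using that by auto
    ultimately have "fps_cong ((Suc i choose 2) + (n - i)) (q ^ (Suc i choose 2) * (?I * ?b j)) (q ^ (Suc i choose 2) * 1)"
      by (intro fps_cong_mult_power q) simp
    then show ?thesis
      by (rule fps_cong_mono) (simp add: numeral_2_eq_2)
  qed
  have "fps_cong n (?I * (qpochhammer_inf (- q) q)\<^sup>2 * 2) (?I * (2 * (qpochhammer (- q) q n)\<^sup>2))"
    using fps_cong_mult[OF fps_cong_refl[of n "?I * 2"] fps_cong_power[OF fps_cong_qpochhammer_inf[OF q(1), of n "- q"], of 2]]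
    by (simp add: mult_ac)
  also have "\<dots> = ?I * (\<Sum>i\<le>n. q ^ (Suc i choose 2) * (?b (n - i) + ?b (n + 1 + i)))"
    using gauss_finite[OF q(2), of n] by simp
  also have "\<dots> = (\<Sum>i\<le>n. q ^ (Suc i choose 2) * (?I * ?b (n - i)) + q ^ (Suc i choose 2) * (?I * ?b (n + 1 + i)))"
    by (simp add: sum_distrib_left distrib_left mult_ac)
  also have "fps_cong n \<dots> (\<Sum>i\<le>n. q ^ (Suc i choose 2) * 1 + q ^ (Suc i choose 2) * 1)"
    by (intro fps_cong_sum fps_cong_add b) auto
  also have "\<dots> = (\<Sum>i\<le>n. q ^ (Suc i choose 2)) * 2"
    by (simp add: sum_distrib_left mult.commute)
  finally show ?thesis
    by (rule fps_cong_cancel) simp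
qed


subsection \<open>Partitions with restricted multiplicities\<close>

definition mult_partitions :: "(nat \<Rightarrow> nat set) \<Rightarrow> nat set \<Rightarrow> nat \<Rightarrow> nat multiset set" where
  "mult_partitions C I n = {\<mu>. set_mset \<mu> \<subseteq> I \<and> (\<forall>i\<in>I. count \<mu> i \<in> C i) \<and> sum_mset \<mu> = n}"

text \<open>For \<open>i > 0\<close> this is the sum of \<open>q\<^bsup>ic\<^esup>\<close> over \<open>c \<in> A\<close>: the part \<open>i\<close> occurs \<open>c\<close> times.\<close>

definition part_series :: "nat set \<Rightarrow> nat \<Rightarrow> 'a::comm_ring_1 fps" where
  "part_series A i = Abs_fps (\<lambda>n. of_bool (i dvd n \<and> n div i \<in> A))"

text \<open>Deleting all copies of i is a bijection onto the partitions of n - k with parts in I;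
  its inverse adds k div i copies.\<close>

lemma card_mult_partitions_insert:
  assumes "i \<notin> I" "i > 0" "k \<le> n"
  shows "card {\<mu> \<in> mult_partitions C (insert i I) n. i * count \<mu> i = k} =
    of_bool (i dvd k \<and> k div i \<in> C i) * card (mult_partitions C I (n - k))"
proof (cases "i dvd k \<and> k div i \<in> C i")
  case True
  then obtain c where c: "k = i * c" "c \<in> C i"
    using assms by auto
  have "bij_betw (\<lambda>\<mu>. \<mu> + replicate_mset c i) (mult_partitions C I (n - k))
      {\<mu> \<in> mult_partitions C (insert i I) n. i * count \<mu> i = k}"
  proof (rule bij_betwI[where g = "filter_mset (\<lambda>j. j \<noteq> i)"])
    show "(\<lambda>\<mu>. \<mu> + replicate_mset c i) \<in> mult_partitions C I (n - k) \<rightarrow>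
        {\<mu> \<in> mult_partitions C (insert i I) n. i * count \<mu> i = k}"
    proof
      fix \<mu> assume \<mu>: "\<mu> \<in> mult_partitions C I (n - k)"
      then have "count \<mu> i = 0"
        using assms(1) by (auto simp: mult_partitions_def simp flip: not_in_iff)
      then show "\<mu> + replicate_mset c i \<in> {\<mu> \<in> mult_partitions C (insert i I) n. i * count \<mu> i = k}"
        using \<mu> assms c by (auto simp: mult_partitions_def)
    qed
  next
    show "filter_mset (\<lambda>j. j \<noteq> i) \<in> {\<mu> \<in> mult_partitions C (insert i I) n. i * count \<mu> i = k}
        \<rightarrow> mult_partitions C I (n - k)"
    proof
      fix \<mu> assume \<mu>: "\<mu> \<in> {\<mu> \<in> mult_partitions C (insert i I) n. i * count \<mu> i = k}"
      have "\<mu> = filter_mset (\<lambda>j. j \<noteq> i) \<mu> + replicate_mset (count \<mu> i) i"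
        by (subst multiset_partition[of \<mu> "\<lambda>j. j \<noteq> i"]) (simp add: filter_eq_replicate_mset)
      from arg_cong[OF this, of sum_mset]
      have "sum_mset (filter_mset (\<lambda>j. j \<noteq> i) \<mu>) = n - k"
        using \<mu> by (auto simp: mult_partitions_def mult.commute)
      then show "filter_mset (\<lambda>j. j \<noteq> i) \<mu> \<in> mult_partitions C I (n - k)"
        using \<mu> assms(1) by (auto simp: mult_partitions_def)
    qed
  next
    fix \<mu> assume "\<mu> \<in> mult_partitions C I (n - k)"
    then have "i \<notin># \<mu>"
      using assms(1) by (auto simp: mult_partitions_def)
    then show "filter_mset (\<lambda>j. j \<noteq> i) (\<mu> + replicate_mset c i) = \<mu>"
      by (auto simp: multiset_eq_iff not_in_iff)
  next
    fix \<mu> assume "\<mu> \<in> {\<mu> \<in> mult_partitions C (insert i I) n. i * count \<mu> i = k}"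
    then have "count \<mu> i = c"
      using c assms(2) by simp
    then show "filter_mset (\<lambda>j. j \<noteq> i) \<mu> + replicate_mset c i = \<mu>"
      by (auto simp: multiset_eq_iff)
  qed
  then show ?thesis
    using True by (simp add: bij_betw_same_card)
next
  case False
  then have "{\<mu> \<in> mult_partitions C (insert i I) n. i * count \<mu> i = k} = {}"
    using assms(2) by (auto simp: mult_partitions_def)
  then show ?thesis
    by (simp only: False card.empty) simp
qed

lemma finite_mult_partitions: "0 \<notin> I \<Longrightarrow> finite (mult_partitions C I n)"
  by (rule finite_subset[OF _ finite_partitions_of[of n]])
     (auto simp: mult_partitions_def partitions_of_def)

lemma member_le_sum_mset: "i \<in># \<mu> \<Longrightarrow> i \<le> sum_mset \<mu>" for i :: nat
  by (auto dest: multi_member_split)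

lemma count_mult_le_sum_mset: "i * count \<mu> i \<le> sum_mset \<mu>" for i :: nat
  by (induction \<mu>) auto

text \<open>Sorting partitions by the total k contributed by the copies of i gives the Cauchy
  product with \<open>part_series (C i) i\<close>.\<close>

lemma mult_partitions_gf:
  assumes "finite I" "0 \<notin> I"
  shows "Abs_fps (\<lambda>n. of_nat (card (mult_partitions C I n))) = (\<Prod>i\<in>I. part_series (C i) i :: 'a::comm_ring_1 fps)"
  using assms
proof (induction I rule: finite_induct)
  case empty
  have "mult_partitions C {} n = (if n = 0 then {{#}} else {})" for n
    by (auto simp: mult_partitions_def)
  then show ?case
    by (auto simp: fps_eq_iff)
next
  case (insert i I)
  show ?case
  proof (rule fps_ext)
    fix n
    have "mult_partitions C (insert i I) n =
        (\<Union>k\<in>{0..n}. {\<mu> \<in> mult_partitions C (insert i I) n. i * count \<mu> i = k})"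
      using count_mult_le_sum_mset by (auto simp: mult_partitions_def)
    then have "card (mult_partitions C (insert i I) n) =
        card (\<Union>k\<in>{0..n}. {\<mu> \<in> mult_partitions C (insert i I) n. i * count \<mu> i = k})"
      by simp
    also have "\<dots> = (\<Sum>k=0..n. card {\<mu> \<in> mult_partitions C (insert i I) n. i * count \<mu> i = k})"
      using insert.prems by (intro card_UN_disjoint) (auto simp: finite_mult_partitions)
    also have "\<dots> = (\<Sum>k=0..n. of_bool (i dvd k \<and> k div i \<in> C i) * card (mult_partitions C I (n - k)))"
      using insert.hyps insert.prems by (intro sum.cong refl card_mult_partitions_insert) auto
    finally have "of_nat (card (mult_partitions C (insert i I) n)) =
        (\<Sum>k=0..n. part_series (C i) i $ k * Abs_fps (\<lambda>n. of_nat (card (mult_partitions C I n))) $ (n - k) :: 'a)"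
      by (simp add: part_series_def)
    also have "\<dots> = (part_series (C i) i * (\<Prod>i\<in>I. part_series (C i) i)) $ n"
      using insert.IH insert.prems by (simp add: fps_mult_nth)
    also have "\<dots> = (\<Prod>i\<in>insert i I. part_series (C i) i) $ n"
      using insert.hyps by simp
    finally show "Abs_fps (\<lambda>n. of_nat (card (mult_partitions C (insert i I) n))) $ n
        = (\<Prod>i\<in>insert i I. part_series (C i) i :: 'a fps) $ n"
      by simp
  qed
qed

definition part_gf :: "(nat \<Rightarrow> nat set) \<Rightarrow> 'a::comm_ring_1 fps" where
  "part_gf C = Abs_fps (\<lambda>n. of_nat (card {\<mu> \<in> partitions_of n. \<forall>i>0. count \<mu> i \<in> C i}))"

text \<open>A partition of k < n has no part above N, so larger parts impose only that multiplicity
  0 be allowed.\<close>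

lemma fps_cong_part_gf:
  assumes "\<And>i. i > N \<Longrightarrow> 0 \<in> C i" "n \<le> Suc N"
  shows "fps_cong n (part_gf C) (\<Prod>i\<in>{1..N}. part_series (C i) i)"
proof -
  have gf: "(\<Prod>i\<in>{1..N}. part_series (C i) i) =
      Abs_fps (\<lambda>n. of_nat (card (mult_partitions C {1..N} n)))"
    by (rule mult_partitions_gf[symmetric]) auto
  have "part_gf C $ k = Abs_fps (\<lambda>n. of_nat (card (mult_partitions C {1..N} n))) $ k"
    if k: "k < n" for k
  proof -
    have "{\<mu> \<in> partitions_of k. \<forall>i>0. count \<mu> i \<in> C i} = mult_partitions C {1..N} k"
    proof (intro equalityI subsetI)
      fix \<mu> assume \<mu>: "\<mu> \<in> {\<mu> \<in> partitions_of k. \<forall>i>0. count \<mu> i \<in> C i}"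
      have "i \<le> N" "i > 0" if "i \<in># \<mu>" for i
        using \<mu> k assms(2) member_le_sum_mset[OF that] that
        by (auto simp: partitions_of_def intro!: gr0I)
      then show "\<mu> \<in> mult_partitions C {1..N} k"
        using \<mu> by (auto simp: mult_partitions_def partitions_of_def Suc_le_eq)
    next
      fix \<mu> assume \<mu>: "\<mu> \<in> mult_partitions C {1..N} k"
      have "count \<mu> i \<in> C i" if "i > 0" for i
      proof (cases "i \<le> N")
        case False
        then have "count \<mu> i = 0"
          using \<mu> by (force simp: mult_partitions_def not_in_iff[symmetric])
        then show ?thesis
          using assms(1)[of i] False by simp
      qed (use \<mu> that in \<open>auto simp: mult_partitions_def\<close>)
      then show "\<mu> \<in> {\<mu> \<in> partitions_of k. \<forall>i>0. count \<mu> i \<in> C i}"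
        using \<mu> by (auto simp: mult_partitions_def partitions_of_def)
    qed
    then show ?thesis
      by (simp add: part_gf_def)
  qed
  then show ?thesis
    unfolding gf fps_cong_iff by blast
qed

text \<open>If C and D differ only on the finite set I, their infinite products differ only in the
  factors over I; cross-multiplication avoids division. Multiplicity 0 may be forbidden inside I,
  which is how a part is made compulsory.\<close>

lemma part_gf_exchange:
  assumes "finite I" "0 \<notin> I" "\<And>i. i \<notin> I \<Longrightarrow> C i = D i" "\<And>i. i \<notin> I \<Longrightarrow> 0 \<in> D i"
  shows "part_gf C * (\<Prod>i\<in>I. part_series (D i) i) = part_gf D * (\<Prod>i\<in>I. part_series (C i) i)"
proof (rule fps_eqI_cong)
  fix n
  \<comment> \<open>Large enough both for precision n and to cover I.\<close>
  define N where "N = Max (insert n I)"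
  have N: "n \<le> N" "I \<subseteq> {1..N}"
    using assms(1,2) by (auto simp: N_def Suc_le_eq intro!: gr0I)
  have 0: "0 \<in> C i" "0 \<in> D i" if "i > N" for i
  proof -
    have "i \<notin> I"
      using N(2) that by auto
    then show "0 \<in> C i" "0 \<in> D i"
      using assms(3,4) by auto
  qed
  have split: "(\<Prod>i\<in>{1..N}. part_series (E i) i) =
      (\<Prod>i\<in>{1..N} - I. part_series (E i) i) * (\<Prod>i\<in>I. part_series (E i) i)" for E
    using N(2) by (rule prod.subset_diff) simp
  have *: "(\<Prod>i\<in>{1..N} - I. part_series (C i) i) = (\<Prod>i\<in>{1..N} - I. part_series (D i) i)"
    using assms(3) by (intro prod.cong) auto
  have "fps_cong n (part_gf C * (\<Prod>i\<in>I. part_series (D i) i))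
      ((\<Prod>i\<in>{1..N}. part_series (C i) i) * (\<Prod>i\<in>I. part_series (D i) i))"
    using 0 N(1) by (intro fps_cong_mult fps_cong_part_gf fps_cong_refl) auto
  also have "\<dots> = (\<Prod>i\<in>{1..N}. part_series (D i) i) * (\<Prod>i\<in>I. part_series (C i) i)"
    unfolding split * by (simp only: mult_ac)
  also have "fps_cong n \<dots> (part_gf D * (\<Prod>i\<in>I. part_series (C i) i))"
    using 0 N(1) by (intro fps_cong_mult fps_cong_sym[OF fps_cong_part_gf] fps_cong_refl) auto
  finally show "fps_cong n (part_gf C * (\<Prod>i\<in>I. part_series (D i) i))
      (part_gf D * (\<Prod>i\<in>I. part_series (C i) i))" .
qed

section \<open>Series of a single part\<close>

lemma part_series_01: "i > 0 \<Longrightarrow> part_series {0, 1} i = 1 + fps_X ^ i"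
  by (auto simp: part_series_def fps_eq_iff elim!: dvdE)

lemma part_series_1: "i > 0 \<Longrightarrow> part_series {1} i = fps_X ^ i"
  by (auto simp: part_series_def fps_eq_iff elim!: dvdE)

lemma part_series_pos: "i > 0 \<Longrightarrow> part_series {1..} i = fps_X ^ i * part_series UNIV i"
  by (auto simp: part_series_def fps_eq_iff fps_X_power_mult_nth Suc_le_eq div_greater_zero_iff
      dvd_diff_nat dest: dvd_imp_le dvd_diffD)

text \<open>The geometric series: either i does not occur, or one copy can be removed.\<close>

lemma part_series_UNIV:
  assumes "i > 0"
  shows "part_series UNIV i * (1 - fps_X ^ i) = (1 :: 'a::comm_ring_1 fps)"
proof -
  have "part_series UNIV i = (part_series ({0} \<union> {1..}) i :: 'a fps)"
    by (rule arg_cong2[where f = part_series]) auto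
  also have "\<dots> = 1 + part_series {1..} i"
    using assms by (auto simp: part_series_def fps_eq_iff elim!: dvdE)
  also have "\<dots> = 1 + fps_X ^ i * part_series UNIV i"
    using part_series_pos[OF assms] by simp
  finally show ?thesis
    by (simp add: algebra_simps)
qed


subsection \<open>Partitions without repeated odd or even parts\<close>

definition od_mult :: "nat \<Rightarrow> nat set" where
  "od_mult i = (if odd i then {0, 1} else UNIV)"

definition ed_mult :: "nat \<Rightarrow> nat set" where
  "ed_mult i = (if even i then {0, 1} else UNIV)"

lemma mem_od_mult: "c \<in> od_mult i \<longleftrightarrow> (odd i \<longrightarrow> c \<le> 1)"
  by (auto simp: od_mult_def)

lemma mem_ed_mult: "c \<in> ed_mult i \<longleftrightarrow> (even i \<longrightarrow> c \<le> 1)"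
  by (auto simp: ed_mult_def)

lemma part_gf_od: "part_gf od_mult = Abs_fps (\<lambda>n. of_nat (card (P_od n)))"
proof -
  have "{\<mu> \<in> partitions_of n. \<forall>i>0. count \<mu> i \<in> od_mult i} = P_od n" for n
    by (auto simp: P_od_def mem_od_mult odd_pos)
  then show ?thesis
    by (simp add: part_gf_def)
qed

lemma part_gf_ed: "part_gf ed_mult = Abs_fps (\<lambda>n. of_nat (p_ed n))"
proof -
  have "(\<forall>i>0. count \<mu> i \<in> ed_mult i) \<longleftrightarrow> (\<forall>i. even i \<longrightarrow> count \<mu> i \<le> 1)"
    if "\<mu> \<in> partitions_of n" for \<mu> n
  proof -
    have "count \<mu> 0 = 0"
      using that by (simp add: partitions_of_def not_in_iff)
    then show ?thesis
      unfolding mem_ed_mult by (metis gr0I le0)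
  qed
  then have "{\<mu> \<in> partitions_of n. \<forall>i>0. count \<mu> i \<in> ed_mult i} =
      {\<mu> \<in> partitions_of n. \<forall>i. even i \<longrightarrow> count \<mu> i \<le> 1}" for n
    by blast
  then show ?thesis
    by (simp add: part_gf_def p_ed_def)
qed

lemma prod_even_odd: "(\<Prod>i\<in>{1..2 * n}. f i) = (\<Prod>k<n. f (2 * k + 1)) * (\<Prod>k<n. f (2 * k + 2))"
  for f :: "nat \<Rightarrow> 'a::comm_monoid_mult"
  by (induction n) (simp_all add: mult_ac)

text \<open>Passage to the limit from products over the parts 1, ..., 2n, that is, over n odd and n
  even parts.\<close>

lemma part_gf_eq_qpochhammer_inf:
  fixes a b :: "'a::comm_ring_1 fps"
  assumes "\<And>i. 0 \<in> C i"
    and "\<And>n. (\<Prod>i\<in>{1..2 * n}. part_series (C i) i) * qpochhammer a (fps_X\<^sup>2) n = qpochhammer b (fps_X\<^sup>2) n"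
  shows "part_gf C * qpochhammer_inf a (fps_X\<^sup>2) = qpochhammer_inf b (fps_X\<^sup>2)"
proof (rule fps_eqI_cong)
  fix n
  have X: "(fps_X\<^sup>2 :: 'a fps) $ 0 = 0"
    by (simp add: power2_eq_square)
  have "fps_cong n (part_gf C * qpochhammer_inf a (fps_X\<^sup>2))
      ((\<Prod>i\<in>{1..2 * n}. part_series (C i) i) * qpochhammer a (fps_X\<^sup>2) n)"
    using assms(1) by (intro fps_cong_mult fps_cong_part_gf fps_cong_qpochhammer_inf X) auto
  also note assms(2)
  also have "fps_cong n (qpochhammer b (fps_X\<^sup>2) n) (qpochhammer_inf b (fps_X\<^sup>2))"
    by (rule fps_cong_sym[OF fps_cong_qpochhammer_inf[OF X]])
  finally show "fps_cong n (part_gf C * qpochhammer_inf a (fps_X\<^sup>2)) (qpochhammer_inf b (fps_X\<^sup>2))" .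
qed

lemma mult_power2_power:
  fixes q :: "'a::monoid_mult"
  shows "q * (q\<^sup>2) ^ k = q ^ (2 * k + 1)" "q\<^sup>2 * (q\<^sup>2) ^ k = q ^ (2 * k + 2)"
  by (simp_all add: add.commute flip: power_mult power_add)

lemma prod_part_series_01:
  "(\<Prod>k<n. part_series {0, 1} (2 * k + 1)) = qpochhammer (- fps_X) (fps_X\<^sup>2) n"
  "(\<Prod>k<n. part_series {0, 1} (2 * k + 2)) = qpochhammer (- (fps_X\<^sup>2)) (fps_X\<^sup>2) n"
  unfolding qpochhammer_def
  by (intro prod.cong refl; simp only: mult_minus_left mult_power2_power diff_minus_eq_add;
      intro part_series_01; simp)+

lemma prod_part_series_UNIV:
  "(\<Prod>k<n. part_series UNIV (2 * k + 1)) * qpochhammer fps_X (fps_X\<^sup>2) n = 1"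
  "(\<Prod>k<n. part_series UNIV (2 * k + 2)) * qpochhammer (fps_X\<^sup>2) (fps_X\<^sup>2) n = 1"
  unfolding qpochhammer_def prod.distrib[symmetric] mult_power2_power
  by (intro prod.neutral ballI part_series_UNIV; simp)+

lemma part_gf_od_product:
  "part_gf od_mult * qpochhammer_inf (fps_X\<^sup>2) (fps_X\<^sup>2) = qpochhammer_inf (- fps_X) (fps_X\<^sup>2)"
proof (rule part_gf_eq_qpochhammer_inf)
  fix n
  have "(\<Prod>i\<in>{1..2 * n}. part_series (od_mult i) i) * qpochhammer (fps_X\<^sup>2) (fps_X\<^sup>2) n =
      (\<Prod>k<n. part_series {0, 1} (2 * k + 1)) *
      ((\<Prod>k<n. part_series UNIV (2 * k + 2)) * qpochhammer (fps_X\<^sup>2) (fps_X\<^sup>2) n)"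
    unfolding prod_even_odd by (simp add: od_mult_def mult.assoc)
  then show "(\<Prod>i\<in>{1..2 * n}. part_series (od_mult i) i) * qpochhammer (fps_X\<^sup>2) (fps_X\<^sup>2) n =
      qpochhammer (- fps_X) (fps_X\<^sup>2) n"
    unfolding prod_part_series_01 prod_part_series_UNIV by simp
qed (simp add: mem_od_mult)

lemma part_gf_ed_product:
  "part_gf ed_mult * qpochhammer_inf fps_X (fps_X\<^sup>2) = qpochhammer_inf (- (fps_X\<^sup>2)) (fps_X\<^sup>2)"
proof (rule part_gf_eq_qpochhammer_inf)
  fix n
  have "(\<Prod>i\<in>{1..2 * n}. part_series (ed_mult i) i) * qpochhammer fps_X (fps_X\<^sup>2) n =
      (\<Prod>k<n. part_series {0, 1} (2 * k + 2)) *
      ((\<Prod>k<n. part_series UNIV (2 * k + 1)) * qpochhammer fps_X (fps_X\<^sup>2) n)"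
    unfolding prod_even_odd by (simp add: ed_mult_def mult_ac)
  then show "(\<Prod>i\<in>{1..2 * n}. part_series (ed_mult i) i) * qpochhammer fps_X (fps_X\<^sup>2) n =
      qpochhammer (- (fps_X\<^sup>2)) (fps_X\<^sup>2) n"
    unfolding prod_part_series_01 prod_part_series_UNIV by simp
qed (simp add: mem_ed_mult)


subsection \<open>Minimal excludants\<close>

text \<open>The least t is the number of m < t, and m < t means that P fails up to m. Any bound N
  beyond some witness makes the sum finite.\<close>

lemma Least_eq_sum_of_bool:
  fixes P :: "nat \<Rightarrow> bool"
  assumes "P n" "n \<le> N"
  shows "(LEAST t. P t) = (\<Sum>m<N. of_bool (\<forall>k<Suc m. \<not> P k))"
proof -
  define t where "t = (LEAST t. P t)"
  have t: "P t" "t \<le> N"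
    using assms LeastI[of P n] Least_le[of P n] unfolding t_def by auto
  have "(\<forall>k<Suc m. \<not> P k) \<longleftrightarrow> m < t" for m
    using t(1) not_less_Least[of _ P] unfolding t_def[symmetric] by (metis less_Suc_eq_le le_less_trans not_le)
  then have "(\<Sum>m<N. of_bool (\<forall>k<Suc m. \<not> P k)) = card ({..<N} \<inter> {m. m < t})"
    by (simp add: sum_of_bool_eq)
  also have "{..<N} \<inter> {m. m < t} = {..<t}"
    using t(2) by auto
  finally show ?thesis
    by (simp add: t_def)
qed

lemma moex_eq: "moex \<mu> = 2 * (LEAST t. 2 * t + 1 \<notin># \<mu>) + 1"
proof -
  \<comment> \<open>A number exceeding the sum of all parts cannot be a part, so the minimum
    exists.\<close>
  have "2 * sum_mset \<mu> + 1 \<notin># \<mu>"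
    using member_le_sum_mset by fastforce
  then have "\<exists>t. 2 * t + 1 \<notin># \<mu>"
    by blast
  then have "2 * (LEAST t. 2 * t + 1 \<notin># \<mu>) + 1 \<notin># \<mu>"
    by (rule LeastI_ex)
  then show ?thesis
    unfolding moex_def by (intro Least_equality) (auto elim!: oddE intro!: Least_le)
qed

lemma meex_eq: "meex \<mu> = 2 * (LEAST t. 2 * t + 2 \<notin># \<mu>) + 2"
proof -
  have "2 * sum_mset \<mu> + 2 \<notin># \<mu>"
    using member_le_sum_mset by fastforce
  then have "\<exists>t. 2 * t + 2 \<notin># \<mu>"
    by blast
  then have "2 * (LEAST t. 2 * t + 2 \<notin># \<mu>) + 2 \<notin># \<mu>"
    by (rule LeastI_ex)
  moreover have "2 * (LEAST t. 2 * t + 2 \<notin># \<mu>) + 2 \<le> k" if "0 < k" "even k" "k \<notin># \<mu>" for k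
  proof -
    \<comment> \<open>The subtraction is not truncated, as k \<ge> 2.\<close>
    have "k = 2 * (k div 2 - 1) + 2"
      using that(1,2) by (auto elim!: evenE)
    moreover from this have "(LEAST t. 2 * t + 2 \<notin># \<mu>) \<le> k div 2 - 1"
      using that(3) by (intro Least_le) simp
    ultimately show ?thesis
      by linarith
  qed
  ultimately show ?thesis
    unfolding meex_def by (intro Least_equality) auto
qed

section \<open>Partitions containing prescribed parts\<close>

definition od_gf_containing :: "(nat \<Rightarrow> nat) \<Rightarrow> nat \<Rightarrow> 'a::comm_ring_1 fps" where
  "od_gf_containing g m = Abs_fps (\<lambda>n. of_nat (card {\<mu> \<in> P_od n. \<forall>k<m. g k \<in># \<mu>}))"

text \<open>Write the minimum as a sum of indicators and exchange the sums. As g n > n, the number g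
  n is not a part of a partition of n, so for coefficients below N the indicators with m < N
  suffice.\<close>

lemma fps_cong_sum_Least:
  assumes "\<And>k. k < g k"
  shows "fps_cong N (Abs_fps (\<lambda>n. of_nat (\<Sum>\<mu>\<in>P_od n. LEAST t. g t \<notin># \<mu>)))
    (\<Sum>m<N. od_gf_containing g (Suc m))"
  unfolding fps_cong_iff
proof (intro allI impI)
  fix n assume n: "n < N"
  have "(LEAST t. g t \<notin># \<mu>) = (\<Sum>m<N. of_bool (\<forall>k<Suc m. g k \<in># \<mu>))" if "\<mu> \<in> P_od n" for \<mu>
  proof -
    have "g n \<notin># \<mu>"
      using that assms[of n] by (auto simp: P_od_def partitions_of_def dest: member_le_sum_mset)
    from Least_eq_sum_of_bool[of "\<lambda>t. g t \<notin># \<mu>", OF this] n show ?thesis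
      by simp
  qed
  then have "(\<Sum>\<mu>\<in>P_od n. LEAST t. g t \<notin># \<mu>) = (\<Sum>\<mu>\<in>P_od n. \<Sum>m<N. of_bool (\<forall>k<Suc m. g k \<in># \<mu>))"
    by simp
  also have "\<dots> = (\<Sum>m<N. \<Sum>\<mu>\<in>P_od n. of_bool (\<forall>k<Suc m. g k \<in># \<mu>))"
    by (rule sum.swap)
  also have "\<dots> = (\<Sum>m<N. card {\<mu> \<in> P_od n. \<forall>k<Suc m. g k \<in># \<mu>})"
    by (simp only: sum_of_bool_eq finite_P_od Collect_conj_eq Collect_mem_eq of_nat_id)
  finally have eq: "(\<Sum>\<mu>\<in>P_od n. LEAST t. g t \<notin># \<mu>) =
      (\<Sum>m<N. card {\<mu> \<in> P_od n. \<forall>k<Suc m. g k \<in># \<mu>})" .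
  show "Abs_fps (\<lambda>n. of_nat (\<Sum>\<mu>\<in>P_od n. LEAST t. g t \<notin># \<mu>)) $ n
      = (\<Sum>m<N. od_gf_containing g (Suc m)) $ n"
    unfolding od_gf_containing_def fps_sum_nth fps_nth_Abs_fps eq by (rule of_nat_sum)
qed

text \<open>Requiring a part means removing 0 from its allowed multiplicities. Injectivity of g
  turns products over the set of required parts into products over k < m.\<close>

lemma od_gf_containing_exchange:
  assumes "inj g" "\<And>k. g k > 0"
  shows "od_gf_containing g m * (\<Prod>k<m. part_series (od_mult (g k)) (g k)) =
    (part_gf od_mult * (\<Prod>k<m. part_series (od_mult (g k) - {0}) (g k)) :: 'a::comm_ring_1 fps)"
proof -
  let ?I = "g ` {..<m}"
  define C where "C = (\<lambda>i. if i \<in> ?I then od_mult i - {0} else od_mult i)"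
  have "{\<mu> \<in> P_od n. \<forall>k<m. g k \<in># \<mu>} = {\<mu> \<in> partitions_of n. \<forall>i>0. count \<mu> i \<in> C i}" for n
  proof -
    have "(\<forall>i>0. count \<mu> i \<in> C i) \<longleftrightarrow> (\<forall>i. odd i \<longrightarrow> count \<mu> i \<le> 1) \<and> (\<forall>k<m. g k \<in># \<mu>)" for \<mu>
    proof -
      have "count \<mu> i \<in> C i \<longleftrightarrow> (odd i \<longrightarrow> count \<mu> i \<le> 1) \<and> (i \<in> ?I \<longrightarrow> i \<in># \<mu>)" for i
        by (auto simp: C_def mem_od_mult not_in_iff)
      moreover have "i > 0" if "odd i \<or> i \<in> ?I" for i
        using that assms(2) by (auto simp: odd_pos)
      ultimately have "(\<forall>i>0. count \<mu> i \<in> C i) \<longleftrightarrow> (\<forall>i. odd i \<longrightarrow> count \<mu> i \<le> 1) \<and> (\<forall>i\<in>?I. i \<in># \<mu>)"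
        by blast
      then show ?thesis
        by auto
    qed
    then show ?thesis
      by (auto simp: P_od_def)
  qed
  then have "od_gf_containing g m = (part_gf C :: 'a fps)"
    by (simp add: od_gf_containing_def part_gf_def)
  moreover have "part_gf C * (\<Prod>i\<in>?I. part_series (od_mult i) i) =
      (part_gf od_mult * (\<Prod>i\<in>?I. part_series (C i) i) :: 'a fps)"
  proof (rule part_gf_exchange)
    show "0 \<notin> ?I"
      using assms(2) by (metis imageE less_irrefl)
  qed (simp_all add: C_def mem_od_mult)
  moreover have "(\<Prod>i\<in>?I. part_series (C i) i) = (\<Prod>i\<in>?I. part_series (od_mult i - {0}) i :: 'a fps)"
    by (intro prod.cong) (auto simp: C_def)
  moreover have "inj_on g {..<m}"
    using assms(1) by (rule inj_on_subset) simp
  ultimately show ?thesis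
    by (simp add: prod.reindex)
qed

text \<open>Each required odd part i has its factor 1 + X^i replaced by X^i, and 1 + 3 + ... + (2m -
  1) = m^2.\<close>

lemma od_gf_containing_odd:
  "od_gf_containing (\<lambda>k. 2 * k + 1) m * qpochhammer (- fps_X) (fps_X\<^sup>2) m =
    (part_gf od_mult * fps_X ^ (m\<^sup>2) :: 'a::comm_ring_1 fps)"
proof -
  have "(\<Prod>k<m. part_series (od_mult (2 * k + 1) - {0}) (2 * k + 1)) = (\<Prod>k<m. fps_X ^ (2 * k + 1) :: 'a fps)"
  proof (intro prod.cong refl)
    fix k
    have "od_mult (2 * k + 1) - {0} = {1}"
      by (auto simp: od_mult_def)
    then show "part_series (od_mult (2 * k + 1) - {0}) (2 * k + 1) = (fps_X ^ (2 * k + 1) :: 'a fps)"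
      by (simp only:) (rule part_series_1, simp)
  qed
  moreover have "(\<Prod>k<m. fps_X ^ (2 * k + 1)) = (fps_X ^ (m\<^sup>2) :: 'a fps)"
  proof (induction m)
    case (Suc m)
    have "(Suc m)\<^sup>2 = m\<^sup>2 + (2 * m + 1)"
      by (simp add: power2_eq_square)
    then show ?case
      by (simp only: prod.lessThan_Suc Suc.IH power_add[of _ "m\<^sup>2"])
  qed simp
  moreover have "(\<Prod>k<m. part_series (od_mult (2 * k + 1)) (2 * k + 1)) = (qpochhammer (- fps_X) (fps_X\<^sup>2) m :: 'a fps)"
    unfolding prod_part_series_01[symmetric] by (simp add: od_mult_def)
  ultimately show ?thesis
    using od_gf_containing_exchange[of "\<lambda>k. 2 * k + 1" m, where 'a = 'a] by (simp add: inj_def)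
qed

text \<open>Each required even part i has its factor 1/(1 - X^i) replaced by X^i/(1 - X^i). The
  common product \<open>?U\<close> cancels, and 2 + 4 + ... + 2m = 2 C(m+1,2).\<close>

lemma od_gf_containing_even:
  "od_gf_containing (\<lambda>k. 2 * k + 2) m = (part_gf od_mult * (fps_X\<^sup>2) ^ (Suc m choose 2) :: 'a::idom fps)"
proof -
  let ?U = "(\<Prod>k<m. part_series UNIV (2 * k + 2)) :: 'a fps"
  have od: "od_mult (2 * k + 2) = UNIV" "UNIV - {0::nat} = {1..}" for k
    by (auto simp: od_mult_def)
  have "(\<Prod>k<m. part_series {1..} (2 * k + 2)) = (\<Prod>k<m. fps_X ^ (2 * k + 2)) * ?U"
    unfolding prod.distrib[symmetric] by (intro prod.cong refl part_series_pos) simp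
  moreover have "(\<Prod>k<m. fps_X ^ (2 * k + 2)) = (fps_X\<^sup>2 :: 'a fps) ^ (Suc m choose 2)"
  proof (induction m)
    case (Suc m)
    have "Suc (Suc m) choose 2 = (Suc m choose 2) + Suc m"
      by (simp add: numeral_2_eq_2)
    then show ?case
      by (simp only: prod.lessThan_Suc Suc.IH power_add[of "fps_X\<^sup>2"] power_Suc mult_power2_power)
  qed (simp add: binomial_eq_0)
  ultimately have "od_gf_containing (\<lambda>k. 2 * k + 2) m * ?U =
      part_gf od_mult * (fps_X\<^sup>2) ^ (Suc m choose 2) * ?U"
    using od_gf_containing_exchange[of "\<lambda>k. 2 * k + 2" m, where 'a = 'a]
    unfolding od by (simp add: inj_def mult.assoc)
  moreover have "?U \<noteq> 0"
  proof -
    have "?U * qpochhammer (fps_X\<^sup>2) (fps_X\<^sup>2) m = 1"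
      by (rule prod_part_series_UNIV)
    then show ?thesis
      by (metis mult_zero_left zero_neq_one)
  qed
  ultimately show ?thesis
    by (simp only: mult_cancel_right) blast
qed

lemma fps_cong_sigma_star:
  "fps_cong N (sigma_star (- fps_X :: 'a::field fps))
    (2 * (\<Sum>m<N. fps_X ^ ((Suc m)\<^sup>2) * inverse (qpochhammer (- fps_X) (fps_X\<^sup>2) (Suc m))))"
proof -
  let ?q = "- fps_X :: 'a fps"
  let ?f = "\<lambda>m. (- 1) ^ Suc m * ?q ^ ((Suc m)\<^sup>2) / qpochhammer ?q (?q\<^sup>2) (Suc m)"
  have f: "?f m = fps_X ^ ((Suc m)\<^sup>2) * inverse (qpochhammer (- fps_X) (fps_X\<^sup>2) (Suc m))" for m
  proof -
    \<comment> \<open>The signs cancel because m + 1 and its square have the same parity.\<close>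
    have "(- 1) ^ Suc m * ?q ^ ((Suc m)\<^sup>2) = fps_X ^ ((Suc m)\<^sup>2)"
      by (cases "even m") (simp_all add: uminus_power_if del: power_Suc)
    then show ?thesis
      by (simp add: fps_divide_unit qpochhammer_nth_0 del: power_Suc)
  qed
  have "fps_cong n (\<Sum>m<Suc n. ?f m) (\<Sum>m<n. ?f m)" for n
  proof -
    \<comment> \<open>The summand of index n starts beyond degree n, so it does not affect
      coefficients below n.\<close>
    have "n < (Suc n)\<^sup>2"
      by (simp add: power2_eq_square)
    then show ?thesis
      unfolding f by (simp add: fps_cong_iff fps_X_power_mult_nth)
  qed
  moreover have "(\<lambda>n. \<Sum>m<n. ?f m) \<longlonglongrightarrow> suminf ?f"
    by (intro summable_LIMSEQ summable_sigma_star) simp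
  ultimately have "fps_cong N (suminf ?f) (\<Sum>m<N. ?f m)"
    using fps_cong_limit by blast
  then have "fps_cong N (2 * suminf ?f) (2 * (\<Sum>m<N. ?f m))"
    by (intro fps_cong_mult fps_cong_refl)
  then show ?thesis
    unfolding f sigma_star_def .
qed

section \<open>Generating functions of the two sums\<close>

lemma sigma_od_moex_gf:
  "Abs_fps (\<lambda>n. of_nat (sigma_od_moex n)) = part_gf od_mult * (1 + sigma_star (- fps_X) :: 'a::field fps)"
proof (rule fps_eqI_cong)
  fix N
  let ?L = "\<lambda>n. \<Sum>\<mu>\<in>P_od n. LEAST t. 2 * t + 1 \<notin># \<mu>"
  have "sigma_od_moex n = card (P_od n) + 2 * ?L n" for n
    by (simp only: sigma_od_moex_def moex_eq sum.distrib sum_distrib_left card_eq_sum add.commute)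
  then have "Abs_fps (\<lambda>n. of_nat (sigma_od_moex n)) = (part_gf od_mult + 2 * Abs_fps (\<lambda>n. of_nat (?L n)) :: 'a fps)"
    by (simp only: fps_eq_iff part_gf_od mult_2 fps_add_nth fps_nth_Abs_fps of_nat_add) simp
  also have "fps_cong N \<dots> (part_gf od_mult + 2 * (\<Sum>m<N. od_gf_containing (\<lambda>k. 2 * k + 1) (Suc m)))"
    by (intro fps_cong_add fps_cong_mult fps_cong_refl fps_cong_sum_Least) simp
  also have "\<dots> = part_gf od_mult * (1 + 2 * (\<Sum>m<N. fps_X ^ ((Suc m)\<^sup>2) * inverse (qpochhammer (- fps_X) (fps_X\<^sup>2) (Suc m))))"
  proof -
    have "od_gf_containing (\<lambda>k. 2 * k + 1) m =
        part_gf od_mult * (fps_X ^ (m\<^sup>2) * inverse (qpochhammer (- fps_X) (fps_X\<^sup>2) m) :: 'a fps)" for m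
    proof -
      let ?p = "qpochhammer (- fps_X) (fps_X\<^sup>2) m :: 'a fps"
      have "?p * inverse ?p = 1"
        by (rule inverse_mult_eq_1') (simp add: qpochhammer_nth_0)
      then have "od_gf_containing (\<lambda>k. 2 * k + 1) m = od_gf_containing (\<lambda>k. 2 * k + 1) m * ?p * inverse ?p"
        by (simp only: mult.assoc mult_1_right)
      then show ?thesis
        unfolding od_gf_containing_odd by (simp only: mult.assoc)
    qed
    then show ?thesis
      by (simp only: distrib_left mult_1_right sum_distrib_left mult.left_commute)
  qed
  also have "fps_cong N \<dots> (part_gf od_mult * (1 + sigma_star (- fps_X)))"
    by (intro fps_cong_mult fps_cong_add fps_cong_refl fps_cong_sym[OF fps_cong_sigma_star])
  finally show "fps_cong N (Abs_fps (\<lambda>n. of_nat (sigma_od_moex n)))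
      (part_gf od_mult * (1 + sigma_star (- fps_X) :: 'a fps))" .
qed

lemma sigma_od_meex_gf:
  "Abs_fps (\<lambda>n. of_nat (sigma_od_meex n)) =
    2 * (qpochhammer_inf (- fps_X) (fps_X\<^sup>2) * (qpochhammer_inf (- (fps_X\<^sup>2)) (fps_X\<^sup>2))\<^sup>2 :: 'a::field_char_0 fps)"
proof (rule fps_eqI_cong)
  fix N
  let ?L = "\<lambda>n. \<Sum>\<mu>\<in>P_od n. LEAST t. 2 * t + 2 \<notin># \<mu>"
  let ?G = "\<lambda>m. od_gf_containing (\<lambda>k. 2 * k + 2) m :: 'a fps"
  let ?y = "fps_X\<^sup>2 :: 'a fps"
  \<comment> \<open>The constant 2 in \<open>meex_eq\<close> thus supplies the term m = 0 of the sum
    to which Gauss's identity applies.\<close>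
  have G0: "?G 0 = part_gf od_mult"
    by (simp add: od_gf_containing_def part_gf_od)
  have "sigma_od_meex n = 2 * (card (P_od n) + ?L n)" for n
    by (simp only: sigma_od_meex_def meex_eq sum.distrib sum_distrib_left card_eq_sum
        distrib_left mult_1_right add.commute)
  then have "Abs_fps (\<lambda>n. of_nat (sigma_od_meex n)) = (2 * (?G 0 + Abs_fps (\<lambda>n. of_nat (?L n))) :: 'a fps)"
    unfolding G0 by (simp only: fps_eq_iff part_gf_od mult_2 fps_add_nth fps_nth_Abs_fps of_nat_add) simp
  also have "fps_cong N \<dots> (2 * (?G 0 + (\<Sum>m<N. ?G (Suc m))))"
    by (intro fps_cong_add fps_cong_mult fps_cong_refl fps_cong_sum_Least) simp
  also have "\<dots> = 2 * (\<Sum>m\<le>N. ?G m)"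
    by (simp only: sum.atMost_shift)
  also have "\<dots> = 2 * (part_gf od_mult * (\<Sum>m\<le>N. ?y ^ (Suc m choose 2)))"
    by (simp only: od_gf_containing_even sum_distrib_left)
  also have "fps_cong N \<dots> (2 * (part_gf od_mult * (qpochhammer_inf ?y ?y * (qpochhammer_inf (- ?y) ?y)\<^sup>2)))"
    by (intro fps_cong_mult fps_cong_refl fps_cong_sym[OF gauss_triangular]) (simp_all add: power2_eq_square)
  also have "\<dots> = 2 * (qpochhammer_inf (- fps_X) ?y * (qpochhammer_inf (- ?y) ?y)\<^sup>2)"
    by (simp only: part_gf_od_product mult.assoc[symmetric])
  finally show "fps_cong N (Abs_fps (\<lambda>n. of_nat (sigma_od_meex n)))
      (2 * (qpochhammer_inf (- fps_X) ?y * (qpochhammer_inf (- ?y) ?y)\<^sup>2))" .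
qed

theorem theorem1p4:
  shows "(Abs_fps (\<lambda>n. of_nat (sigma_od_moex n)) :: 'a::field_char_0 fps) =
           qpochhammer_inf (- fps_X) (fps_X\<^sup>2) / qpochhammer_inf (fps_X\<^sup>2) (fps_X\<^sup>2)
             * (1 + sigma_star (- fps_X))
       \<and> (Abs_fps (\<lambda>n. of_nat (sigma_od_meex n)) :: 'a fps) =
           2 * Abs_fps (\<lambda>n. of_nat (p_ed n))"
proof
  let ?y = "fps_X\<^sup>2 :: 'a fps"
  have y: "?y $ 0 = 0"
    by (simp add: power2_eq_square)
  have nz: "qpochhammer_inf a ?y \<noteq> 0" if "a $ 0 = 0" for a
    using qpochhammer_inf_nth_0[OF that y] by auto
  have "qpochhammer_inf (- fps_X) ?y / qpochhammer_inf ?y ?y = part_gf od_mult"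
    unfolding part_gf_od_product[symmetric] using nz[OF y] by (rule nonzero_mult_div_cancel_right)
  then show "(Abs_fps (\<lambda>n. of_nat (sigma_od_moex n)) :: 'a fps) =
      qpochhammer_inf (- fps_X) ?y / qpochhammer_inf ?y ?y * (1 + sigma_star (- fps_X))"
    by (simp only: sigma_od_moex_gf)
  let ?A = "qpochhammer_inf fps_X ?y" and ?B = "qpochhammer_inf (- fps_X) ?y"
    and ?E = "qpochhammer_inf (- ?y) ?y"
  \<comment> \<open>Here \<open>?A * ?B\<close> is (X^2;X^4)_inf, and Euler's identity with q = X^2
    applies.\<close>
  have "?A * ?B * ?E = 1"
    using qpochhammer_inf_mult_uminus[OF y, of fps_X] qpochhammer_inf_odd_mult_uminus[OF y] by simp
  \<comment> \<open>Both generating functions are compared after multiplication by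
    \<open>?A\<close>, the denominator of the one for \<open>p_ed\<close>.\<close>
  then have "2 * (?B * ?E\<^sup>2) * ?A = 2 * ?E"
    by (simp add: power2_eq_square mult_ac)
  also have "\<dots> = 2 * part_gf ed_mult * ?A"
    by (simp only: part_gf_ed_product mult.assoc)
  finally show "(Abs_fps (\<lambda>n. of_nat (sigma_od_meex n)) :: 'a fps) = 2 * Abs_fps (\<lambda>n. of_nat (p_ed n))"
    using nz[of fps_X] by (simp add: sigma_od_meex_gf part_gf_ed)
qed

end
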